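(* Let $$\mathcal Z_2=\Big\{\bm X\in\mathcal D:\ \inf_{\mathbb P\in\mathcal P}\mathbb P\Big\{\sum_{j\in\mathcal J}\sum_{t\in\mathcal T}\mathbb I(\tilde\omega_j\le t)\,x_{jt}\le\gamma\Big\}\ge 1-\beta\Big\}.$$ Then $\mathcal Z_2$ can be rewritten as a (non-robust) chance constrained set: $$\mathcal Z_2=\Big\{\bm X\in\mathcal D:\ \mathbb P\Big\{\sum_{j\in\mathcal J}\sum_{t\in\mathcal T}\tilde\eta_{jt}\,x_{jt}\le\gamma\Big\}\ge 1-\beta\Big\},$$ where each $\tilde\eta_{jt}$ is a Bernoulli random variable with $\bar p_{jt}=\mathbb P(\tilde\eta_{jt}=1)=\sup_{\mathbb P\in\mathcal P_j}\mathbb P(\tilde\omega_j\le t)$, $j\in\mathcal J$, $t\in\mathcal T$, and the families $(\tilde\eta_{jt})_{t\in\mathcal T}$, $j\in\mathcal J$, are independent of each other for different $j$.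
   Context: $\mathbb I$ is the indicator function. $\gamma$ is a given nonnegative integer and $\beta\in(0,1)$ a given constant. Sets: $\mathcal J=\{1,\dots,J\}$ components, $\mathcal K=\{1,\dots,K\}$ machines, $\mathcal L=\{1,\dots,L\}$ spare-part types, $\mathcal T=\{1,\dots,T_{max}\}$ periods. $\mathcal J$ is the disjoint union of the sets $\mathcal J_k$ (components of machine $k$), and $\mathcal M_l\subseteq\mathcal J$ is the set of components of type $l$. Uncertainty: $\tilde\omega_j$ is a random variable with values in $\Xi_j=[0,\tau_j^{\max}]$, and $\tilde\Omega=(\tilde\omega_1,\dots,\tilde\omega_J)$ has independent coordinates. For each $j$, $\widehat{\mathrm{RLD}}_j$ is a given probability distribution on $\Xi_j$, $\delta_j\ge0$, $\varphi$ is a given discrepancy functional between probability distributions (nonnegative, zero when the two arguments are equal), $$\mathcal P_j=\{\mathbb P:\ \mathbb P\{\tilde\omega_j\in\Xi_j\}=1,\ \varphi(\mathbb P,\widehat{\mathrm{RLD}}_j)\le\delta_j\},$$ and $\mathcal P=\{\mathbb P_1\otimes\cdots\otimes\mathbb P_J:\ \mathbb P_j\in\mathcal P_j\}$. Deterministic feasible set $\mathcal D$: the set of all vectors $\bm X=(x_{jt},y_{kt},z_t,h_{lt},g^{reg}_{lt},g^{exp}_{lt},r_t)$ with $x_{jt},y_{kt},z_t,r_t\in\{0,1\}$ and $h_{lt},g^{reg}_{lt},g^{exp}_{lt}\in\mathbb Z_+$ such that - $\sum_{t\in\mathcal T}x_{jt}=1$ for all $j\in\mathcal J$; - $\sum_{j\in\mathcal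 J}x_{jt}\le M z_t$ for all $t\in\mathcal T$; - $\sum_{j\in\mathcal J_k}x_{jt}\le|\mathcal J_k|\,y_{kt}$ for all $k\in\mathcal K$, $t\in\mathcal T$; - $\sum_{l\in\mathcal L}g^{reg}_{lt}\le G_t r_t$ for all $t\in\mathcal T$; - $h_{lt}=h_{l,t-1}+g^{exp}_{lt}+\hat g_{lt}-\sum_{j\in\mathcal M_l}x_{jt}$ for all $l\in\mathcal L,t\in\mathcal T$, where $\hat g_{lt}=g^{reg}_{l,t-\Delta^{reg}}$ if $t\ge\Delta^{reg}+1$, and $\hat g_{lt}=\tilde g^{reg}_{l,t-\Delta^{reg}}$ (given past orders) if $1\le t\le\Delta^{reg}$. Here $M$, $G_t$, the lead time $\Delta^{reg}\in\mathbb Z_{>0}$, the initial inventories $h_{l0}$ and the past orders $\tilde g^{reg}$ are given nonnegative data. *)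

theory Defs
  imports "HOL-Probability.Probability"
begin

record system_data =
  n_comp :: nat                             (* J *)
  n_mach :: nat                             (* K *)
  n_type :: nat                             (* L *)
  horizon :: nat                            (* T_max *)
  mach_comps :: "nat \<Rightarrow> nat set"             (* J_k *)
  type_comps :: "nat \<Rightarrow> nat set"             (* M_l *)
  visit_cap :: real                         (* M *)
  order_cap :: "nat \<Rightarrow> real"                 (* G_t *)
  lead_time :: nat                          (* Delta^reg *)
  init_inv :: "nat \<Rightarrow> real"                  (* h_{l0} *)
  past_order :: "nat \<Rightarrow> int \<Rightarrow> real"          (* indexed by periods 1 - Delta^reg, ..., 0 *)

abbreviation comps :: "system_data \<Rightarrow> nat set" where
  "comps S \<equiv> {1..n_comp S}"

abbreviation machs :: "system_data \<Rightarrow> nat set" where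
  "machs S \<equiv> {1..n_mach S}"

abbreviation types :: "system_data \<Rightarrow> nat set" where
  "types S \<equiv> {1..n_type S}"

abbreviation periods :: "system_data \<Rightarrow> nat set" where
  "periods S \<equiv> {1..horizon S}"

definition valid_system :: "system_data \<Rightarrow> bool" where
  "valid_system S \<longleftrightarrow>
     (\<Union>k\<in>machs S. mach_comps S k) = comps S \<and>
     disjoint_family_on (mach_comps S) (machs S) \<and>
     (\<forall>l\<in>types S. type_comps S l \<subseteq> comps S) \<and>
     0 \<le> visit_cap S \<and>
     (\<forall>t\<in>periods S. 0 \<le> order_cap S t) \<and>
     0 < lead_time S \<and>
     (\<forall>l\<in>types S. 0 \<le> init_inv S l) \<and>
     (\<forall>l\<in>types S. \<forall>s\<in>{1 - int (lead_time S)..0}. 0 \<le> past_order S l s)"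

record plan =
  x_var :: "nat \<Rightarrow> nat \<Rightarrow> real"
  y_var :: "nat \<Rightarrow> nat \<Rightarrow> real"
  z_var :: "nat \<Rightarrow> real"
  h_var :: "nat \<Rightarrow> nat \<Rightarrow> real"
  greg_var :: "nat \<Rightarrow> nat \<Rightarrow> real"
  gexp_var :: "nat \<Rightarrow> nat \<Rightarrow> real"
  r_var :: "nat \<Rightarrow> real"

definition prev_inv :: "system_data \<Rightarrow> plan \<Rightarrow> nat \<Rightarrow> nat \<Rightarrow> real" where
  "prev_inv S X l t = (if t = 1 then init_inv S l else h_var X l (t - 1))"

definition arrivals :: "system_data \<Rightarrow> plan \<Rightarrow> nat \<Rightarrow> nat \<Rightarrow> real" where
  "arrivals S X l t =
     (if lead_time S + 1 \<le> t then greg_var X l (t - lead_time S)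
      else past_order S l (int t - int (lead_time S)))"

(* The extensional function spaces fix the entries outside the index ranges, so that
   the elements are exactly the finite vectors; \<nat> is the set of reals 0, 1, 2, ... *)
definition feasible_plans :: "system_data \<Rightarrow> plan set" where
  "feasible_plans S = {X.
     x_var X \<in> comps S \<rightarrow>\<^sub>E (periods S \<rightarrow>\<^sub>E {0, 1}) \<and>
     y_var X \<in> machs S \<rightarrow>\<^sub>E (periods S \<rightarrow>\<^sub>E {0, 1}) \<and>
     z_var X \<in> periods S \<rightarrow>\<^sub>E {0, 1} \<and>
     h_var X \<in> types S \<rightarrow>\<^sub>E (periods S \<rightarrow>\<^sub>E \<nat>) \<and>
     greg_var X \<in> types S \<rightarrow>\<^sub>E (periods S \<rightarrow>\<^sub>E \<nat>) \<and>
     gexp_var X \<in> types S \<rightarrow>\<^sub>E (periods S \<rightarrow>\<^sub>E \<nat>) \<and>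
     r_var X \<in> periods S \<rightarrow>\<^sub>E {0, 1} \<and>
     (\<forall>j\<in>comps S. (\<Sum>t\<in>periods S. x_var X j t) = 1) \<and>
     (\<forall>t\<in>periods S. (\<Sum>j\<in>comps S. x_var X j t) \<le> visit_cap S * z_var X t) \<and>
     (\<forall>k\<in>machs S. \<forall>t\<in>periods S.
        (\<Sum>j\<in>mach_comps S k. x_var X j t) \<le> real (card (mach_comps S k)) * y_var X k t) \<and>
     (\<forall>t\<in>periods S. (\<Sum>l\<in>types S. greg_var X l t) \<le> order_cap S t * r_var X t) \<and>
     (\<forall>l\<in>types S. \<forall>t\<in>periods S.
        h_var X l t = prev_inv S X l t + gexp_var X l t + arrivals S X l t
                      - (\<Sum>j\<in>type_comps S l. x_var X j t))}"

(* Distributions on a Borel set A are represented as Borel probability measures on the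
   real line that give A full mass. *)
definition distribution_on :: "real set \<Rightarrow> real measure \<Rightarrow> bool" where
  "distribution_on A P \<longleftrightarrow> real_distribution P \<and> measure P A = 1"

(* Extended real values, since common discrepancies (e.g. Kullback-Leibler) may be infinite. *)
definition discrepancy :: "(real measure \<Rightarrow> real measure \<Rightarrow> ereal) \<Rightarrow> bool" where
  "discrepancy \<phi> \<longleftrightarrow>
     (\<forall>P Q. real_distribution P \<longrightarrow> real_distribution Q \<longrightarrow> 0 \<le> \<phi> P Q) \<and>
     (\<forall>P. real_distribution P \<longrightarrow> \<phi> P P = 0)"

definition ambiguity_set ::
  "(real measure \<Rightarrow> real measure \<Rightarrow> ereal) \<Rightarrow> real \<Rightarrow> real measure \<Rightarrow> real \<Rightarrow> real measure set" where
  "ambiguity_set \<phi> \<tau> R \<delta> = {P. distribution_on {0..\<tau>} P \<and> \<phi> P R \<le> ereal \<delta>}"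

definition product_laws :: "nat set \<Rightarrow> (nat \<Rightarrow> real measure set) \<Rightarrow> (nat \<Rightarrow> real) measure set" where
  "product_laws I A = {PiM I Q | Q. \<forall>i\<in>I. Q i \<in> A i}"

definition bernoulli_var :: "'w measure \<Rightarrow> ('w \<Rightarrow> real) \<Rightarrow> real \<Rightarrow> bool" where
  "bernoulli_var N X p \<longleftrightarrow>
     X \<in> borel_measurable N \<and> (AE w in N. X w \<in> {0, 1}) \<and>
     measure N {w \<in> space N. X w = 1} = p"

end

theory Submission
  imports Defs
begin

text \<open>
  In a feasible plan each component \<open>j\<close> is replaced in exactly one period \<open>s j\<close>. Its
  contribution to the sum is therefore the indicator of the single event
  \<open>\<omega> j \<le> s j\<close> (respectively the variable \<open>\<eta> j (s j)\<close>), and the chance constraint says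
  that at most \<open>\<gamma>\<close> of these events occur. The events of different components are
  independent, so the probability of this depends only on their individual
  probabilities \<open>p j\<close>: it is the distribution function of a sum of independent Bernoulli
  variables, an explicit polynomial in \<open>p\<close> (\<open>prob_card_less\<close>).

  On \<open>[0,1]\<close> this polynomial is nonincreasing in every \<open>p j\<close> (\<open>count_below_antimono\<close>), and it
  is continuous. Since the marginals of a product law range independently over the
  nonempty ambiguity sets, its infimum over all product laws is its value at the
  componentwise suprema (\<open>INF_count_below\<close>), even if no supremum is attained. These suprema
  are the success probabilities of \<open>\<eta> j (s j)\<close>. Hence for every feasible plan the
  worst-case probability equals the probability under \<open>N\<close>, which is stronger than the
  equality of the two sets. Dependence between \<open>\<eta> j t\<close> and \<open>\<eta> j t'\<close> is harmless because
  only one period per component matters.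
\<close>

section \<open>The distribution function of a sum of independent Bernoulli variables\<close>

text \<open>
  The probability that fewer than \<open>n\<close> of the independent events indexed by \<open>I\<close>, with
  probabilities \<open>p i\<close>, occur; \<open>A\<close> is the set of those that occur. The strict bound makes
  \<open>n = 0\<close> the degenerate case with value \<open>0\<close>, so that the recursion on \<open>I\<close>, which
  lowers the bound by one when an event occurs, also covers the bound \<open>Suc 0\<close>.
\<close>
definition count_below :: "'i set \<Rightarrow> ('i \<Rightarrow> real) \<Rightarrow> nat \<Rightarrow> real" where
  "count_below I p n =
     (\<Sum>A\<in>{A. A \<subseteq> I \<and> card A < n}. (\<Prod>i\<in>A. p i) * (\<Prod>i\<in>I - A. 1 - p i))"

lemma count_below_0: "count_below I p 0 = 0"
  by (simp add: count_below_def)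

lemma count_below_cong:
  assumes "\<And>i. i \<in> I \<Longrightarrow> p i = q i"
  shows "count_below I p n = count_below I q n"
  unfolding count_below_def
  using assms by (intro sum.cong arg_cong2[where f = "(*)"] prod.cong) auto

text \<open>Conditioning on whether the event with index \<open>i\<close> occurs.\<close>
lemma count_below_insert:
  assumes "finite I" and "i \<notin> I"
  shows "count_below (insert i I) p (Suc n) =
           p i * count_below I p n + (1 - p i) * count_below I p (Suc n)"
proof -
  let ?w = "\<lambda>J A. (\<Prod>i\<in>A. p i) * (\<Prod>i\<in>J - A. 1 - p i)"
  let ?B = "{A. A \<subseteq> I \<and> card A < n}" and ?C = "{A. A \<subseteq> I \<and> card A < Suc n}"
  have fin: "finite A" if "A \<subseteq> I" for A
    using that assms(1) finite_subset by auto
  have split: "{A. A \<subseteq> insert i I \<and> card A < Suc n} = insert i ` ?B \<union> ?C" (is "?L = ?R")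
  proof (intro equalityI subsetI)
    fix A assume A: "A \<in> ?L"
    show "A \<in> ?R"
    proof (cases "i \<in> A")
      case True
      then have "A - {i} \<subseteq> I" and "A = insert i (A - {i})"
        using A by auto
      moreover have "finite A"
        using A assms(1) finite_subset[of A "insert i I"] by auto
      then have "card (A - {i}) < n"
        using A True card_Suc_Diff1[of A i] by auto
      ultimately show ?thesis by blast
    next
      case False
      then show ?thesis using A by auto
    qed
  next
    fix A assume "A \<in> ?R"
    then show "A \<in> ?L"
      using fin assms(2) by (auto simp: card_insert_if)
  qed
  have fin_sets: "finite ?B" "finite ?C"
    using assms(1) by auto
  have "count_below (insert i I) p (Suc n) =
          (\<Sum>A\<in>insert i ` ?B. ?w (insert i I) A) + (\<Sum>A\<in>?C. ?w (insert i I) A)"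
    unfolding count_below_def split
    by (rule sum.union_disjoint) (use fin_sets assms(2) in auto)
  also have "(\<Sum>A\<in>insert i ` ?B. ?w (insert i I) A) =
               (\<Sum>A\<in>?B. ?w (insert i I) (insert i A))"
    by (rule sum.reindex[unfolded o_def])
      (use assms(2) in \<open>auto simp: inj_on_def insert_ident\<close>)
  also have "\<dots> = (\<Sum>A\<in>?B. p i * ?w I A)"
  proof (rule sum.cong[OF refl])
    fix A assume "A \<in> ?B"
    then have "A \<subseteq> I" by simp
    moreover have "insert i I - insert i A = I - A"
      using assms(2) \<open>A \<subseteq> I\<close> by auto
    moreover have "i \<notin> A" using assms(2) \<open>A \<subseteq> I\<close> by auto
    ultimately show "?w (insert i I) (insert i A) = p i * ?w I A"
      using fin by simp
  qed
  also have "(\<Sum>A\<in>?C. ?w (insert i I) A) = (\<Sum>A\<in>?C. (1 - p i) * ?w I A)"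
  proof (rule sum.cong[OF refl])
    fix A assume "A \<in> ?C"
    then have "insert i I - A = insert i (I - A)"
      using assms(2) by auto
    then show "?w (insert i I) A = (1 - p i) * ?w I A"
      using assms by (simp add: mult.left_commute)
  qed
  finally show ?thesis
    by (simp add: count_below_def sum_distrib_left)
qed

lemma count_below_le_Suc:
  assumes "finite I" and "\<And>i. i \<in> I \<Longrightarrow> 0 \<le> p i \<and> p i \<le> 1"
  shows "count_below I p n \<le> count_below I p (Suc n)"
  unfolding count_below_def
proof (rule sum_mono2)
  fix A assume "A \<in> {A. A \<subseteq> I \<and> card A < Suc n} - {A. A \<subseteq> I \<and> card A < n}"
  then show "0 \<le> (\<Prod>i\<in>A. p i) * (\<Prod>i\<in>I - A. 1 - p i)"
    using assms(2) by (intro mult_nonneg_nonneg prod_nonneg) auto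
qed (use assms(1) in auto)

text \<open>
  In the recursion the coefficient of \<open>p i\<close> is a difference of the form
  \<open>count_below I p m - count_below I p (Suc m)\<close>, which is nonpositive by the previous lemma.
\<close>
lemma count_below_antimono:
  assumes "finite I" and "\<And>i. i \<in> I \<Longrightarrow> 0 \<le> p i \<and> p i \<le> q i \<and> q i \<le> 1"
  shows "count_below I q n \<le> count_below I p n"
  using assms
proof (induction I arbitrary: n rule: finite_induct)
  case empty
  then show ?case by (simp add: count_below_def)
next
  case (insert i I)
  show ?case
  proof (cases n)
    case 0
    then show ?thesis by (simp add: count_below_0)
  next
    case (Suc m)
    have pq: "0 \<le> q i" "0 \<le> 1 - q i" "p i \<le> q i"
      using insert.prems[of i] by auto
    have le: "count_below I q k \<le> count_below I p k" for k
      using insert.IH insert.prems by auto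
    have step: "count_below I p m \<le> count_below I p (Suc m)"
      using insert.hyps insert.prems by (intro count_below_le_Suc) force+
    have "count_below (insert i I) q n =
            q i * count_below I q m + (1 - q i) * count_below I q (Suc m)"
      using Suc insert.hyps by (simp add: count_below_insert)
    also have "\<dots> \<le> q i * count_below I p m + (1 - q i) * count_below I p (Suc m)"
      using pq le by (intro add_mono mult_left_mono) auto
    also have "\<dots> = count_below I p (Suc m) - q i * (count_below I p (Suc m) - count_below I p m)"
      by (simp add: algebra_simps)
    also have "\<dots> \<le> count_below I p (Suc m) - p i * (count_below I p (Suc m) - count_below I p m)"
      using pq step by (intro diff_left_mono mult_right_mono) auto
    also have "\<dots> = count_below (insert i I) p n"
      using Suc insert.hyps by (simp add: count_below_insert algebra_simps)
    finally show ?thesis .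
  qed
qed

lemma count_below_tendsto:
  assumes "\<And>i. i \<in> I \<Longrightarrow> (\<lambda>m. p m i) \<longlonglongrightarrow> q i"
  shows "(\<lambda>m. count_below I (p m) n) \<longlonglongrightarrow> count_below I q n"
  unfolding count_below_def
  using assms by (intro tendsto_intros) auto

lemma (in prob_space) prob_card_less:
  fixes B :: "'i \<Rightarrow> 'a \<Rightarrow> bool"
  assumes "finite I" and ind: "indep_vars (\<lambda>_. count_space UNIV) B I"
  shows "{w \<in> space M. card {i \<in> I. B i w} < n} \<in> events"
    and "prob {w \<in> space M. card {i \<in> I. B i w} < n} =
           count_below I (\<lambda>i. prob {w \<in> space M. B i w}) n"
proof -
  let ?p = "\<lambda>i. prob {w \<in> space M. B i w}"
  let ?E = "\<lambda>A. {w \<in> space M. {i \<in> I. B i w} = A}"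
  have B[measurable]: "B i \<in> measurable M (count_space UNIV)" if "i \<in> I" for i
    using ind that unfolding indep_vars_def by auto
  have compl: "prob {w \<in> space M. \<not> B i w} = 1 - ?p i" if "i \<in> I" for i
    using that by (intro prob_neg) measurable
  have E: "?E A \<in> events \<and> prob (?E A) = (\<Prod>i\<in>A. ?p i) * (\<Prod>i\<in>I - A. 1 - ?p i)"
    if A: "A \<subseteq> I" for A
  proof (cases "I = {}")
    case True
    then have "?E A = space M" using A by auto
    then show ?thesis using A True by (simp add: prob_space)
  next
    case False
    have eq: "?E A = (\<Inter>i\<in>I. B i -` {i \<in> A} \<inter> space M)"
      using A False by auto
    have "prob (?E A) = (\<Prod>i\<in>I. prob (B i -` {i \<in> A} \<inter> space M))"
      unfolding eq by (rule indep_varsD_finite[OF ind False assms(1)]) simp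
    also have "\<dots> = (\<Prod>i\<in>I. if i \<in> A then ?p i else 1 - ?p i)"
    proof (rule prod.cong[OF refl])
      fix i assume i: "i \<in> I"
      show "prob (B i -` {i \<in> A} \<inter> space M) = (if i \<in> A then ?p i else 1 - ?p i)"
        using compl[OF i] by (auto intro!: arg_cong[where f = prob] simp flip: compl[OF i])
    qed
    also have "\<dots> = (\<Prod>i\<in>A. ?p i) * (\<Prod>i\<in>I - A. 1 - ?p i)"
    proof -
      have "I \<inter> A = A" "I \<inter> - A = I - A" using A by auto
      then show ?thesis
        using assms(1) by (simp add: prod.If_cases)
    qed
    moreover have "?E A \<in> events"
      unfolding eq using False assms(1) B by (intro sets.finite_INT measurable_sets[OF B]) auto
    ultimately show ?thesis by simp
  qed
  let ?C = "{A. A \<subseteq> I \<and> card A < n}"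
  have U: "{w \<in> space M. card {i \<in> I. B i w} < n} = (\<Union>A\<in>?C. ?E A)"
    by auto
  have fin: "finite ?C"
    using assms(1) by auto
  show "{w \<in> space M. card {i \<in> I. B i w} < n} \<in> events"
    unfolding U using E fin by (intro sets.finite_UN) auto
  have "prob (\<Union>A\<in>?C. ?E A) = (\<Sum>A\<in>?C. prob (?E A))"
    using E fin by (intro finite_measure_finite_Union) (auto simp: disjoint_family_on_def)
  also have "\<dots> = count_below I ?p n"
    unfolding count_below_def using E by (intro sum.cong) auto
  finally show "prob {w \<in> space M. card {i \<in> I. B i w} < n} = count_below I ?p n"
    unfolding U .
qed


section \<open>The infimum over independently chosen marginals\<close>

text \<open>
  Here \<open>V i\<close> is the set of admissible choices for index \<open>i\<close> and \<open>f i u\<close> the probability that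
  choice \<open>u\<close> gives to the event with index \<open>i\<close>.
\<close>
lemma INF_count_below:
  fixes f :: "'i \<Rightarrow> 'b \<Rightarrow> real"
  assumes fin: "finite I" and ne: "\<And>i. i \<in> I \<Longrightarrow> V i \<noteq> {}"
    and f01: "\<And>i v. i \<in> I \<Longrightarrow> v \<in> V i \<Longrightarrow> 0 \<le> f i v \<and> f i v \<le> 1"
  shows "(INF v\<in>Pi I V. count_below I (\<lambda>i. f i (v i)) n) =
           count_below I (\<lambda>i. SUP u\<in>V i. f i u) n"
proof (rule antisym)
  let ?s = "\<lambda>i. SUP u\<in>V i. f i u"
  have bdd: "bdd_above (f i ` V i)" if "i \<in> I" for i
    using f01[OF that] by (intro bdd_aboveI2[where M = 1]) auto
  have s1: "?s i \<le> 1" if "i \<in> I" for i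
    using ne[OF that] f01[OF that] by (intro cSUP_least) auto
  have lower: "count_below I ?s n \<le> count_below I (\<lambda>i. f i (v i)) n" if "v \<in> Pi I V" for v
    using that f01 s1 bdd
    by (intro count_below_antimono fin) (auto intro!: cSUP_upper simp: Pi_iff)
  have "Pi I V \<noteq> {}"
    using ne by (simp add: Pi_eq_empty)
  then show "count_below I ?s n \<le> (INF v\<in>Pi I V. count_below I (\<lambda>i. f i (v i)) n)"
    using lower by (intro cINF_greatest)
  \<comment> \<open>The suprema need not be attained: approach all of them simultaneously along a sequence
    of choices and use continuity.\<close>
  have "\<exists>u\<in>V i. ?s i - 1 / real (Suc m) < f i u" if "i \<in> I" for i m
  proof -
    have "?s i - 1 / real (Suc m) < ?s i" by simp
    then show ?thesis
      using less_cSUP_iff[OF ne[OF that] bdd[OF that]] by blast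
  qed
  then have "\<forall>m. \<forall>i\<in>I. \<exists>u. u \<in> V i \<and> ?s i - 1 / real (Suc m) < f i u"
    by blast
  then have "\<forall>m. \<exists>v. \<forall>i\<in>I. v i \<in> V i \<and> ?s i - 1 / real (Suc m) < f i (v i)"
    by (intro allI bchoice) blast
  then obtain v where v: "\<And>i m. i \<in> I \<Longrightarrow> v m i \<in> V i \<and> ?s i - 1 / real (Suc m) < f i (v m i)"
    unfolding choice_iff by blast
  have "(\<lambda>m. f i (v m i)) \<longlonglongrightarrow> ?s i" if i: "i \<in> I" for i
  proof (rule tendsto_sandwich)
    show "\<forall>\<^sub>F m in sequentially. ?s i - 1 / real (Suc m) \<le> f i (v m i)"
      using v[OF i] by (intro always_eventually allI less_imp_le) blast
    show "\<forall>\<^sub>F m in sequentially. f i (v m i) \<le> ?s i"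
      using v[OF i] bdd[OF i] by (intro always_eventually allI cSUP_upper) auto
    show "(\<lambda>m. ?s i - 1 / real (Suc m)) \<longlonglongrightarrow> ?s i"
      using tendsto_diff[OF tendsto_const LIMSEQ_inverse_real_of_nat, of "?s i"]
      by (simp add: inverse_eq_divide)
  qed simp
  then have "(\<lambda>m. count_below I (\<lambda>i. f i (v m i)) n) \<longlonglongrightarrow> count_below I ?s n"
    by (rule count_below_tendsto)
  moreover have "(INF v\<in>Pi I V. count_below I (\<lambda>i. f i (v i)) n)
                   \<le> count_below I (\<lambda>i. f i (v m i)) n" for m
    using lower v by (intro cINF_lower bdd_belowI2[where m = "count_below I ?s n"]) auto
  ultimately show "(INF v\<in>Pi I V. count_below I (\<lambda>i. f i (v i)) n) \<le> count_below I ?s n"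
    by (intro LIMSEQ_le_const) auto
qed

section \<open>Product laws\<close>

lemma indep_vars_PiM_components:
  assumes "\<And>i. i \<in> I \<Longrightarrow> prob_space (M i)"
  shows "prob_space.indep_vars (PiM I M) M (\<lambda>i \<omega>. \<omega> i) I"
proof -
  interpret P: prob_space "PiM I M"
    using assms by (rule prob_space_PiM)
  show ?thesis
  proof (cases "I = {}")
    case True
    then show ?thesis
      unfolding P.indep_vars_def P.indep_sets_def by blast
  next
    case False
    have "distr (PiM I M) (PiM I M) (\<lambda>\<omega>. \<lambda>i\<in>I. \<omega> i) = distr (PiM I M) (PiM I M) (\<lambda>\<omega>. \<omega>)"
      by (intro distr_cong) (auto simp: space_PiM)
    also have "\<dots> = PiM I (\<lambda>i. distr (PiM I M) (M i) (\<lambda>\<omega>. \<omega> i))"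
      using assms by (simp add: distr_id distr_PiM_component cong: PiM_cong)
    finally show ?thesis
      using False by (subst P.indep_vars_iff_distr_eq_PiM') auto
  qed
qed

lemma prob_card_less_PiM:
  assumes "finite I" and dist: "\<And>i. i \<in> I \<Longrightarrow> real_distribution (Q i)"
  shows "measure (PiM I Q) {\<omega> \<in> space (PiM I Q). card {i \<in> I. \<omega> i \<le> c i} < n} =
           count_below I (\<lambda>i. measure (Q i) {w \<in> space (Q i). w \<le> c i}) n"
proof -
  have ps: "prob_space (Q i)" and [measurable_cong]: "sets (Q i) = sets borel" if "i \<in> I" for i
    using dist[OF that] by (auto simp: real_distribution_def real_distribution_axioms_def)
  interpret P: prob_space "PiM I Q"
    using ps by (rule prob_space_PiM)
  have "P.indep_vars (\<lambda>_. count_space UNIV) (\<lambda>i \<omega>. \<omega> i \<le> c i) I"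
    by (rule P.indep_vars_compose2[OF indep_vars_PiM_components[OF ps]]) measurable
  note P.prob_card_less(2)[OF assms(1) this, of n]
  also have "count_below I (\<lambda>i. measure (PiM I Q) {\<omega> \<in> space (PiM I Q). \<omega> i \<le> c i}) n =
             count_below I (\<lambda>i. measure (Q i) {w \<in> space (Q i). w \<le> c i}) n"
  proof (rule count_below_cong)
    fix i assume i: "i \<in> I"
    have "measure (Q i) {w \<in> space (Q i). w \<le> c i} =
          measure (distr (PiM I Q) (Q i) (\<lambda>\<omega>. \<omega> i)) {w \<in> space (Q i). w \<le> c i}"
      using ps i by (simp add: distr_PiM_component)
    also have "\<dots> = measure (PiM I Q) ((\<lambda>\<omega>. \<omega> i) -` {w \<in> space (Q i). w \<le> c i} \<inter> space (PiM I Q))"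
      using i by (intro measure_distr) measurable
    also have "(\<lambda>\<omega>. \<omega> i) -` {w \<in> space (Q i). w \<le> c i} \<inter> space (PiM I Q) =
               {\<omega> \<in> space (PiM I Q). \<omega> i \<le> c i}"
      using i by (auto simp: space_PiM)
    finally show "measure (PiM I Q) {\<omega> \<in> space (PiM I Q). \<omega> i \<le> c i} =
                  measure (Q i) {w \<in> space (Q i). w \<le> c i}" by simp
  qed
  finally show ?thesis .
qed

section \<open>Reduction of the chance constraint\<close>

text \<open>A 0/1 vector with sum \<open>1\<close> is a unit vector, so weighting by it evaluates at one index.\<close>
lemma sum_eq_1_unique:
  fixes x :: "'a \<Rightarrow> real"
  assumes "finite A" and x: "\<And>t. t \<in> A \<Longrightarrow> x t \<in> {0, 1}" and "(\<Sum>t\<in>A. x t) = 1"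
  obtains s where "s \<in> A" and "\<And>g. (\<Sum>t\<in>A. g t * x t) = g s"
proof -
  obtain s where s: "s \<in> A" "x s \<noteq> 0"
    using assms(3) by (metis sum.neutral zero_neq_one)
  then have "x s = 1" using x by auto
  moreover from this have "(\<Sum>t\<in>A - {s}. x t) = 0"
    using assms s by (simp add: sum_diff1)
  then have "\<forall>t\<in>A - {s}. x t = 0"
    using assms(1) x by (subst (asm) sum_nonneg_eq_0_iff) force+
  ultimately have "(\<Sum>t\<in>A. g t * x t) = g s" for g
    using s assms(1) by (simp add: sum.remove)
  with s show ?thesis using that by blast
qed

theorem proposition3:
  fixes S :: system_data
    and \<phi> :: "real measure \<Rightarrow> real measure \<Rightarrow> ereal"
    and \<tau> \<delta> :: "nat \<Rightarrow> real"
    and RLD :: "nat \<Rightarrow> real measure"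
    and \<gamma> :: nat and \<beta> :: real
    and N :: "'w measure"
    and \<eta> :: "nat \<Rightarrow> nat \<Rightarrow> 'w \<Rightarrow> real"
  defines "\<P> \<equiv> \<lambda>j. ambiguity_set \<phi> (\<tau> j) (RLD j) (\<delta> j)"
  assumes "valid_system S"
    and "0 < \<beta>" and "\<beta> < 1"
    and "discrepancy \<phi>"
    and "\<And>j. j \<in> comps S \<Longrightarrow> distribution_on {0..\<tau> j} (RLD j)"
    and "\<And>j. j \<in> comps S \<Longrightarrow> 0 \<le> \<delta> j"
    and "prob_space N"
    and "\<And>j t. j \<in> comps S \<Longrightarrow> t \<in> periods S \<Longrightarrow>
           bernoulli_var N (\<eta> j t) (SUP P\<in>\<P> j. measure P {w \<in> space P. w \<le> real t})"
    and "prob_space.indep_vars N (\<lambda>j. PiM (periods S) (\<lambda>t. borel))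
           (\<lambda>j w. \<lambda>t\<in>periods S. \<eta> j t w) (comps S)"
  shows "{X \<in> feasible_plans S.
            (INF P\<in>product_laws (comps S) \<P>.
               measure P {\<omega> \<in> space P.
                 (\<Sum>j\<in>comps S. \<Sum>t\<in>periods S. of_bool (\<omega> j \<le> real t) * x_var X j t) \<le> real \<gamma>})
            \<ge> 1 - \<beta>}
       = {X \<in> feasible_plans S.
            measure N {w \<in> space N.
                 (\<Sum>j\<in>comps S. \<Sum>t\<in>periods S. \<eta> j t w * x_var X j t) \<le> real \<gamma>}
            \<ge> 1 - \<beta>}"
proof -
  let ?I = "comps S"
  let ?G = "\<lambda>P X. measure P {\<omega> \<in> space P.
      (\<Sum>j\<in>?I. \<Sum>t\<in>periods S. of_bool (\<omega> j \<le> real t) * x_var X j t) \<le> real \<gamma>}"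
  let ?H = "\<lambda>X. measure N {w \<in> space N.
      (\<Sum>j\<in>?I. \<Sum>t\<in>periods S. \<eta> j t w * x_var X j t) \<le> real \<gamma>}"
  interpret N: prob_space N by fact
  have "(INF P\<in>product_laws ?I \<P>. ?G P X) = ?H X" if X: "X \<in> feasible_plans S" for X
  proof -
    have "\<exists>s\<in>periods S. \<forall>g. (\<Sum>t\<in>periods S. g t * x_var X j t) = g s" if j: "j \<in> ?I" for j
    proof (rule sum_eq_1_unique[of "periods S" "x_var X j"])
      have "x_var X \<in> ?I \<rightarrow>\<^sub>E (periods S \<rightarrow>\<^sub>E {0, 1})"
        and "\<forall>j\<in>?I. (\<Sum>t\<in>periods S. x_var X j t) = 1"
        using X unfolding feasible_plans_def by blast+
      then show "\<And>t. t \<in> periods S \<Longrightarrow> x_var X j t \<in> {0, 1}" "sum (x_var X j) (periods S) = 1"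
        using j by (auto dest!: PiE_mem)
    qed auto
    then obtain s where s: "\<And>j. j \<in> ?I \<Longrightarrow> s j \<in> periods S"
      and sum_s: "\<And>j g. j \<in> ?I \<Longrightarrow> (\<Sum>t\<in>periods S. g t * x_var X j t) = g (s j)"
      by metis
    define p where "p = (\<lambda>j P. measure P {w \<in> space P. w \<le> real (s j)})"
    have amb: "real_distribution P" if "P \<in> \<P> j" for P j
      using that by (simp add: \<P>_def ambiguity_set_def distribution_on_def)
    \<comment> \<open>The ambiguity sets are nonempty: the reference law has discrepancy \<open>0\<close> from itself.\<close>
    have RLD: "RLD j \<in> \<P> j" if "j \<in> ?I" for j
      using assms that
      by (auto simp: \<P>_def ambiguity_set_def distribution_on_def discrepancy_def)
    have "?G (PiM ?I Q) X = count_below ?I (\<lambda>j. p j (Q j)) (Suc \<gamma>)" if "Q \<in> Pi ?I \<P>" for Q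
    proof -
      have "(\<Sum>j\<in>?I. \<Sum>t\<in>periods S. of_bool (\<omega> j \<le> real t) * x_var X j t) =
            real (card {j \<in> ?I. \<omega> j \<le> real (s j)})" for \<omega>
      proof -
        have "(\<Sum>j\<in>?I. \<Sum>t\<in>periods S. of_bool (\<omega> j \<le> real t) * x_var X j t) =
              (\<Sum>j\<in>?I. of_bool (\<omega> j \<le> real (s j)))"
          by (intro sum.cong refl sum_s)
        then show ?thesis
          by (simp add: sum_of_bool_eq Int_def)
      qed
      then have "{\<omega> \<in> space (PiM ?I Q).
              (\<Sum>j\<in>?I. \<Sum>t\<in>periods S. of_bool (\<omega> j \<le> real t) * x_var X j t) \<le> real \<gamma>} =
            {\<omega> \<in> space (PiM ?I Q). card {j \<in> ?I. \<omega> j \<le> real (s j)} < Suc \<gamma>}"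
        by (simp only: less_Suc_eq_le of_nat_le_iff)
      moreover have "real_distribution (Q j)" if "j \<in> ?I" for j
        using \<open>Q \<in> Pi ?I \<P>\<close> that by (intro amb[of "Q j" j]) (rule Pi_mem)
      ultimately show ?thesis
        unfolding p_def by (simp only:) (intro prob_card_less_PiM finite_atLeastAtMost)
    qed
    moreover have "product_laws ?I \<P> = PiM ?I ` Pi ?I \<P>"
      by (auto simp: product_laws_def)
    ultimately have "(INF P\<in>product_laws ?I \<P>. ?G P X) =
        (INF Q\<in>Pi ?I \<P>. count_below ?I (\<lambda>j. p j (Q j)) (Suc \<gamma>))"
      by (simp only: image_image cong: image_cong)
    also have "\<dots> = count_below ?I (\<lambda>j. SUP P\<in>\<P> j. p j P) (Suc \<gamma>)"
    proof (rule INF_count_below)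
      fix j P assume "P \<in> \<P> j"
      then interpret P: real_distribution P by (rule amb)
      show "0 \<le> p j P \<and> p j P \<le> 1"
        by (simp add: p_def)
    qed (use RLD in auto)
    also have "\<dots> = ?H X"
    proof -
      let ?B = "\<lambda>j w. \<eta> j (s j) w = 1"
      have bern: "bernoulli_var N (\<eta> j (s j)) (SUP P\<in>\<P> j. p j P)" if "j \<in> ?I" for j
        unfolding p_def using assms that s by blast
      have "N.indep_vars (\<lambda>_. count_space UNIV)
              (\<lambda>j w. (\<lambda>f. f (s j) = (1::real)) (\<lambda>t\<in>periods S. \<eta> j t w)) ?I"
      proof (rule N.indep_vars_compose2[OF assms(10), where Y = "\<lambda>j f. f (s j) = 1"])
        fix j assume "j \<in> ?I"
        then have [measurable]: "s j \<in> periods S" by (rule s)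
        show "(\<lambda>f. f (s j) = (1::real)) \<in> (\<Pi>\<^sub>M t\<in>periods S. borel) \<rightarrow>\<^sub>M count_space UNIV"
          by measurable
      qed
      then have ind: "N.indep_vars (\<lambda>_. count_space UNIV) ?B ?I"
        using s by (subst (asm) N.indep_vars_cong[OF refl _ refl]) auto
      have sum_eta: "(\<Sum>j\<in>?I. \<Sum>t\<in>periods S. \<eta> j t w * x_var X j t) = (\<Sum>j\<in>?I. \<eta> j (s j) w)"
        for w
        by (intro sum.cong refl sum_s)
      have [measurable]: "\<eta> j (s j) \<in> borel_measurable N" if "j \<in> ?I" for j
        using bern[OF that] by (simp add: bernoulli_var_def)
      \<comment> \<open>The variables \<open>\<eta>\<close> are 0/1-valued only almost surely, so the two events below agree
        only up to a null set.\<close>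
      have "AE w in N. \<forall>j\<in>?I. \<eta> j (s j) w \<in> {0, 1}"
        using bern by (intro AE_finite_allI) (auto simp: bernoulli_var_def)
      then have "AE w in N. (\<Sum>j\<in>?I. \<Sum>t\<in>periods S. \<eta> j t w * x_var X j t) \<le> real \<gamma>
                   \<longleftrightarrow> card {j \<in> ?I. ?B j w} < Suc \<gamma>"
      proof eventually_elim
        case (elim w)
        have "(\<Sum>j\<in>?I. \<eta> j (s j) w) = (\<Sum>j\<in>?I. of_bool (?B j w))"
          using elim by (intro sum.cong) auto
        also have "\<dots> = real (card {j \<in> ?I. ?B j w})"
          by (simp add: sum_of_bool_eq Int_def)
        finally show ?case
          by (simp only: sum_eta less_Suc_eq_le of_nat_le_iff)
      qed
      then have "?H X = measure N {w \<in> space N. card {j \<in> ?I. ?B j w} < Suc \<gamma>}"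
        using N.prob_card_less(1)[OF _ ind]
        unfolding sum_eta by (intro measure_eq_AE) simp_all
      also have "\<dots> = count_below ?I (\<lambda>j. measure N {w \<in> space N. ?B j w}) (Suc \<gamma>)"
        using ind by (intro N.prob_card_less) auto
      also have "\<dots> = count_below ?I (\<lambda>j. SUP P\<in>\<P> j. p j P) (Suc \<gamma>)"
        using bern by (intro count_below_cong) (simp add: bernoulli_var_def)
      finally show ?thesis by simp
    qed
    finally show ?thesis .
  qed
  then show ?thesis by (simp cong: conj_cong)
qed

end
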